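(* Let $k\in\{1,2\}$ and consider the scheme: given $g_h^n\in V^h$, find $g_h^{n+1}\in V^h$ with $$\langle\mathcal M g_h^{n+1},\phi_h\rangle+\Delta t\,\langle D\mathcal M\nabla g_h^{n+1},\nabla\phi_h\rangle+\Delta t\,\langle\vec u\,g_h^{n+1},\nabla\phi_h\rangle=\langle\mathcal M g_h^n,\phi_h\rangle\qquad\forall\phi_h\in V^h .$$ Assume the velocity field satisfies the discrete divergence free constraint $$\langle\vec u,\nabla\phi_h\rangle=0\qquad\forall\phi_h\in V^h .$$ If the scheme is monotone, then for any convex function $f:\mathbb R\to\mathbb R$ it dissipates the discrete energy: $$\sum_{i=1}^{N^2}\omega_i\mathcal M_i\,f\Big(\frac{\rho_i^{n+1}}{\mathcal M_i}\Big)\le\sum_{i=1}^{N^2}\omega_i\mathcal M_i\,f\Big(\frac{\rho_i^{n}}{\mathcal M_i}\Big),$$ where $\rho_i^n=\mathcal M_ig_i^n$.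
   Context: $\Omega=[-L,L]^2$ with a uniform square mesh $\mathcal E_h$; $D>0$ constant, $\Delta t>0$; $\mathcal M>0$ is a given positive continuous function on $\bar\Omega$ (the invariant measure) and $\vec u$ a given velocity field on $\bar\Omega$. $V^h=\{v_h\in C(\Omega):v_h|_E\in\mathbb Q^k(E)\ \forall E\in\mathcal E_h\}$, where $\mathbb Q^k(E)$ is the space of polynomials on $E$ of degree at most $k$ in each variable. $\langle\cdot,\cdot\rangle$ denotes the $L^2(\Omega)$ inner product in which the integral on each cell is evaluated by the tensor-product $(k+1)\times(k+1)$-point Gauss–Lobatto quadrature (gradients evaluated from inside each cell). All quadrature points form a uniform $N\times N$ grid, indexed by $i=1,\dots,N^2$; $\{\phi_i\}_{i=1}^{N^2}$ is the Lagrangian basis of $V^h$ at these points, $g_i^n$ and $\mathcal M_i$ are the values of $g_h^n$ and $\mathcal M$ at the $i$-th point, and $\omega_i=\langle\phi_i,\phi_i\rangle>0$ is the corresponding (assembled) quadrature weight. In matrix form the scheme is $A\vec g_h^{\,n+1}=WM\vec g_h^{\,n}$ with $W=\mathrm{diag}(\omega_1,\dots,\omega_{N^2})$, $M=\mathrm{diag}(\mathcal M_1,\dots,\mathcal M_{N^2})$ and $A_{ij}=[WM]_{ij}+\Delta t\,\langle D\mathcal M\nabla\phi_j,\nabla\phi_i\rangle+\Delta t\,\langle\vec u\,\phi_j,\nabla\phi_i\rangle$. The scheme is called monotone if $A$ is invertible and all entries of $A^{-1}$ are nonnegative. *)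

theory Defs
  imports "HOL-Analysis.Analysis" "Jordan_Normal_Form.Matrix"
begin

text \<open>Parameters used throughout: \<open>L\<close> is the half width of the domain, \<open>m\<close> the number of mesh
  cells per coordinate direction, and \<open>k\<close> the polynomial degree.\<close>

definition Omega :: "real \<Rightarrow> (real \<times> real) set" where
  "Omega L = cbox (-L, -L) (L, L)"

definition mesh_size :: "real \<Rightarrow> nat \<Rightarrow> real" where
  "mesh_size L m = 2 * L / real m"

definition cell :: "real \<Rightarrow> nat \<Rightarrow> nat \<Rightarrow> nat \<Rightarrow> (real \<times> real) set" where
  "cell L m a b =
     (let h = mesh_size L m
      in cbox (-L + real a * h, -L + real b * h) (-L + real (a + 1) * h, -L + real (b + 1) * h))"

definition mesh :: "real \<Rightarrow> nat \<Rightarrow> (real \<times> real) set set" where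
  "mesh L m = {cell L m a b | a b. a < m \<and> b < m}"

definition is_Qk_on :: "nat \<Rightarrow> (real \<times> real) set \<Rightarrow> (real \<times> real \<Rightarrow> real) \<Rightarrow> bool" where
  "is_Qk_on k E v \<longleftrightarrow>
     (\<exists>c :: nat \<Rightarrow> nat \<Rightarrow> real. \<forall>x y. (x, y) \<in> E \<longrightarrow> v (x, y) = (\<Sum>i\<le>k. \<Sum>j\<le>k. c i j * x ^ i * y ^ j))"

text \<open>The elements of \<open>Vh\<close> are total functions on the plane; their values outside of \<open>Omega L\<close> are
  unconstrained, and none of the notions below depends on them.\<close>

definition Vh :: "nat \<Rightarrow> real \<Rightarrow> nat \<Rightarrow> (real \<times> real \<Rightarrow> real) set" where
  "Vh k L m = {v. continuous_on (Omega L) v \<and> (\<forall>E\<in>mesh L m. is_Qk_on k E v)}"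

text \<open>The \<open>(k+1)\<close>-point Gauss--Lobatto rule on \<open>[-1,1]\<close>, tabulated for \<open>k = 1\<close> (trapezoidal rule)
  and \<open>k = 2\<close> (Simpson's rule); the values for other \<open>k\<close> are meaningless. It is the rule with
  \<open>k+1\<close> nodes, including both end points, that is exact up to degree \<open>2k-1\<close>; the lemma checks
  the exactness of the table.\<close>

definition gl_node :: "nat \<Rightarrow> nat \<Rightarrow> real" where
  "gl_node k p = (if k = 1 then [-1, 1] ! p else [-1, 0, 1] ! p)"

definition gl_weight :: "nat \<Rightarrow> nat \<Rightarrow> real" where
  "gl_weight k p = (if k = 1 then [1, 1] ! p else [1/3, 4/3, 1/3] ! p)"

lemma gl_exact:
  assumes "k = 1 \<or> k = 2" "d \<le> 2 * k - 1"
  shows "((\<lambda>x. x ^ d) has_integral (\<Sum>p<k+1. gl_weight k p * gl_node k p ^ d)) {-1..1}"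
proof -
  have "((\<lambda>x::real. x ^ d) has_integral (1 ^ Suc d / real (Suc d) - (-1) ^ Suc d / real (Suc d))) {-1..1}"
  proof (rule fundamental_theorem_of_calculus)
    fix x :: real
    have "((\<lambda>x. x ^ Suc d / real (Suc d)) has_real_derivative real (Suc d) * x ^ d / real (Suc d)) (at x within {-1..1})"
      by (rule DERIV_cdivide) (rule derivative_eq_intros refl | simp)+
    then show "((\<lambda>x. x ^ Suc d / real (Suc d)) has_vector_derivative x ^ d) (at x within {-1..1})"
      by (simp add: has_real_derivative_iff_has_vector_derivative del: power_Suc of_nat_Suc)
  qed simp
  moreover have "1 ^ Suc d / real (Suc d) - (-1) ^ Suc d / real (Suc d)
      = (\<Sum>p<k+1. gl_weight k p * gl_node k p ^ d)"
  proof -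
    have "d = 0 \<or> d = 1 \<or> d = 2 \<or> d = 3" using assms by auto
    then show ?thesis using assms
      by (auto simp: gl_weight_def gl_node_def eval_nat_numeral)
  qed
  ultimately show ?thesis by simp
qed

definition quad_point :: "nat \<Rightarrow> real \<Rightarrow> nat \<Rightarrow> nat \<Rightarrow> nat \<Rightarrow> nat \<Rightarrow> nat \<Rightarrow> real \<times> real" where
  "quad_point k L m a b p q =
     (let h = mesh_size L m
      in (-L + h * (real a + (1 + gl_node k p) / 2), -L + h * (real b + (1 + gl_node k q) / 2)))"

text \<open>The quadrature inner product. The arguments also depend on the cell, because gradients of
  elements of \<open>Vh\<close> take different values on the two sides of a cell interface.\<close>

definition dip :: "nat \<Rightarrow> real \<Rightarrow> nat \<Rightarrow> ((real \<times> real) set \<Rightarrow> real \<times> real \<Rightarrow> 'b::real_inner)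
    \<Rightarrow> ((real \<times> real) set \<Rightarrow> real \<times> real \<Rightarrow> 'b) \<Rightarrow> real" where
  "dip k L m F G =
     (\<Sum>a<m. \<Sum>b<m. \<Sum>p<k+1. \<Sum>q<k+1.
        (mesh_size L m / 2)\<^sup>2 * gl_weight k p * gl_weight k q *
        (let E = cell L m a b; x = quad_point k L m a b p q in F E x \<bullet> G E x))"

text \<open>The gradient from inside the cell \<open>E\<close>: the derivative is taken within \<open>E\<close>, hence one-sided
  on its boundary.\<close>

definition grad :: "(real \<times> real \<Rightarrow> real) \<Rightarrow> (real \<times> real) set \<Rightarrow> real \<times> real \<Rightarrow> real \<times> real" where
  "grad v E x = (frechet_derivative v (at x within E) (1, 0), frechet_derivative v (at x within E) (0, 1))"

definition grid_size :: "nat \<Rightarrow> nat \<Rightarrow> nat" where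
  "grid_size k m = k * m + 1"

text \<open>All quadrature points, numbered row by row from \<open>0\<close> to \<open>N\<^sup>2 - 1\<close>, where \<open>N = grid_size k m\<close>.
  They are equally spaced because \<open>k\<close> is \<open>1\<close> or \<open>2\<close>.\<close>

definition grid_point :: "nat \<Rightarrow> real \<Rightarrow> nat \<Rightarrow> nat \<Rightarrow> real \<times> real" where
  "grid_point k L m i =
     (let N = grid_size k m; d = mesh_size L m / real k
      in (-L + real (i mod N) * d, -L + real (i div N) * d))"

definition lagrange_basis :: "nat \<Rightarrow> real \<Rightarrow> nat \<Rightarrow> (nat \<Rightarrow> real \<times> real \<Rightarrow> real) \<Rightarrow> bool" where
  "lagrange_basis k L m \<phi> \<longleftrightarrow>
     (\<forall>i<(grid_size k m)\<^sup>2. \<phi> i \<in> Vh k L m \<and>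
        (\<forall>j<(grid_size k m)\<^sup>2. \<phi> i (grid_point k L m j) = (if i = j then 1 else 0)))"

definition quad_weight :: "nat \<Rightarrow> real \<Rightarrow> nat \<Rightarrow> (nat \<Rightarrow> real \<times> real \<Rightarrow> real) \<Rightarrow> nat \<Rightarrow> real" where
  "quad_weight k L m \<phi> i = dip k L m (\<lambda>_. \<phi> i) (\<lambda>_. \<phi> i)"

definition is_scheme_step :: "nat \<Rightarrow> real \<Rightarrow> nat \<Rightarrow> real \<Rightarrow> real \<Rightarrow> (real \<times> real \<Rightarrow> real)
    \<Rightarrow> (real \<times> real \<Rightarrow> real \<times> real) \<Rightarrow> (real \<times> real \<Rightarrow> real) \<Rightarrow> (real \<times> real \<Rightarrow> real) \<Rightarrow> bool" where
  "is_scheme_step k L m D dt \<M> u g g' \<longleftrightarrow>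
     g \<in> Vh k L m \<and> g' \<in> Vh k L m \<and>
     (\<forall>\<psi>\<in>Vh k L m.
        dip k L m (\<lambda>_ x. \<M> x * g' x) (\<lambda>_. \<psi>)
        + dt * dip k L m (\<lambda>E x. (D * \<M> x) *\<^sub>R grad g' E x) (grad \<psi>)
        + dt * dip k L m (\<lambda>_ x. g' x *\<^sub>R u x) (grad \<psi>)
        = dip k L m (\<lambda>_ x. \<M> x * g x) (\<lambda>_. \<psi>))"

definition discrete_div_free :: "nat \<Rightarrow> real \<Rightarrow> nat \<Rightarrow> (real \<times> real \<Rightarrow> real \<times> real) \<Rightarrow> bool" where
  "discrete_div_free k L m u \<longleftrightarrow> (\<forall>\<psi>\<in>Vh k L m. dip k L m (\<lambda>_. u) (grad \<psi>) = 0)"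

definition scheme_matrix :: "nat \<Rightarrow> real \<Rightarrow> nat \<Rightarrow> real \<Rightarrow> real \<Rightarrow> (real \<times> real \<Rightarrow> real)
    \<Rightarrow> (real \<times> real \<Rightarrow> real \<times> real) \<Rightarrow> (nat \<Rightarrow> real \<times> real \<Rightarrow> real) \<Rightarrow> real mat" where
  "scheme_matrix k L m D dt \<M> u \<phi> =
     (let n = (grid_size k m)\<^sup>2;
          W = mat_diag n (quad_weight k L m \<phi>);
          M = mat_diag n (\<lambda>i. \<M> (grid_point k L m i))
      in Matrix.mat n n (\<lambda>(i, j). (W * M) $$ (i, j)
           + dt * dip k L m (\<lambda>E x. (D * \<M> x) *\<^sub>R grad (\<phi> j) E x) (grad (\<phi> i))
           + dt * dip k L m (\<lambda>_ x. \<phi> j x *\<^sub>R u x) (grad (\<phi> i))))"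

definition monotone_matrix :: "real mat \<Rightarrow> bool" where
  "monotone_matrix A \<longleftrightarrow> square_mat A \<and>
     (\<exists>B. inverts_mat A B \<and> inverts_mat B A \<and>
        (\<forall>i<dim_row B. \<forall>j<dim_col B. 0 \<le> B $$ (i, j)))"

definition monotone_scheme :: "nat \<Rightarrow> real \<Rightarrow> nat \<Rightarrow> real \<Rightarrow> real \<Rightarrow> (real \<times> real \<Rightarrow> real)
    \<Rightarrow> (real \<times> real \<Rightarrow> real \<times> real) \<Rightarrow> (nat \<Rightarrow> real \<times> real \<Rightarrow> real) \<Rightarrow> bool" where
  "monotone_scheme k L m D dt \<M> u \<phi> \<longleftrightarrow> monotone_matrix (scheme_matrix k L m D dt \<M> u \<phi>)"

end

theory Submission
  imports Defs
begin

text \<open>Write \<open>w\<^sub>i\<close> for \<open>\<omega>\<^sub>i \<M>\<^sub>i\<close>. Testing the scheme with \<open>\<phi>\<^sub>i\<close> gives \<open>A g\<^sup>n\<^sup>+\<^sup>1 = diag(w) g\<^sup>n\<close>. Since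
  the gradient of a constant vanishes, the column sums of \<open>A\<close> are the \<open>w\<^sub>j\<close>; since \<open>u\<close> is discretely
  divergence free, so are its row sums. Hence \<open>C = A\<^sup>-\<^sup>1 diag(w)\<close> is nonnegative, has row sums \<open>1\<close>,
  and leaves the weights \<open>w\<close> invariant under left multiplication. As \<open>g\<^sup>n\<^sup>+\<^sup>1 = C g\<^sup>n\<close>, Jensen's
  inequality in each row, weighted by \<open>w\<^sub>i\<close> and summed over \<open>i\<close>, is the claim.\<close>

section \<open>Jensen's inequality for a matrix with invariant weights\<close>

lemma Jensen_invariant_weights:
  fixes A B :: "nat \<Rightarrow> nat \<Rightarrow> real" and w x y :: "nat \<Rightarrow> real"
  assumes f: "convex_on UNIV f"
    and w: "\<And>i. i < n \<Longrightarrow> 0 \<le> w i"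
    and B: "\<And>i j. i < n \<Longrightarrow> j < n \<Longrightarrow> 0 \<le> B i j"
    and AB: "\<And>i j. i < n \<Longrightarrow> j < n \<Longrightarrow> (\<Sum>l<n. A i l * B l j) = (if i = j then 1 else 0)"
    and BA: "\<And>i j. i < n \<Longrightarrow> j < n \<Longrightarrow> (\<Sum>l<n. B i l * A l j) = (if i = j then 1 else 0)"
    and rows: "\<And>i. i < n \<Longrightarrow> (\<Sum>j<n. A i j) = w i"
    and cols: "\<And>j. j < n \<Longrightarrow> (\<Sum>i<n. A i j) = w j"
    and step: "\<And>i. i < n \<Longrightarrow> (\<Sum>j<n. A i j * y j) = w i * x i"
  shows "(\<Sum>i<n. w i * f (y i)) \<le> (\<Sum>i<n. w i * f (x i))"
proof -
  \<comment> \<open>\<open>B\<close> undoes \<open>A\<close> on every vector \<open>v\<close>. It is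
    applied below to \<open>y\<close>, where \<open>step\<close> evaluates \<open>A y\<close>, and
    to the constant vector 1, where \<open>rows\<close> does.\<close>
  have inverse_apply: "(\<Sum>j<n. B i j * (\<Sum>l<n. A j l * v l)) = v i" if "i < n" for i v
  proof -
    have "(\<Sum>j<n. B i j * (\<Sum>l<n. A j l * v l)) = (\<Sum>j<n. \<Sum>l<n. B i j * A j l * v l)"
      by (simp add: sum_distrib_left mult.assoc)
    also have "\<dots> = (\<Sum>l<n. (\<Sum>j<n. B i j * A j l) * v l)"
      by (subst sum.swap) (simp add: sum_distrib_right)
    also have "\<dots> = (\<Sum>l<n. if l = i then v l else 0)"
      using that BA by (intro sum.cong) auto
    also have "\<dots> = v i"
      using that by simp
    finally show ?thesis .
  qed
  have y: "y i = (\<Sum>j<n. B i j * w j * x j)" if "i < n" for i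
    using inverse_apply [OF that, of y] step by (simp add: mult.assoc)
  have stochastic: "(\<Sum>j<n. B i j * w j) = 1" if "i < n" for i
    using inverse_apply [OF that, of "\<lambda>_. 1"] rows by simp
  \<comment> \<open>By \<open>cols\<close>, \<open>w\<close> is the row vector 1 \<open>A\<close>,
    so \<open>w B\<close> = 1 \<open>A B\<close> = 1 by \<open>AB\<close>. Scaling column j by
    \<open>w j\<close> then returns the weight \<open>w j\<close>.\<close>
  have invariant: "(\<Sum>i<n. w i * B i j) = 1" if "j < n" for j
  proof -
    have "(\<Sum>i<n. w i * B i j) = (\<Sum>i<n. \<Sum>l<n. A l i * B i j)"
      using cols by (simp add: sum_distrib_right [symmetric])
    also have "\<dots> = (\<Sum>l<n. \<Sum>i<n. A l i * B i j)"
      by (rule sum.swap)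
    also have "\<dots> = (\<Sum>l<n. if l = j then 1 else 0)"
      using that AB by simp
    finally show ?thesis using that by simp
  qed
  have "(\<Sum>i<n. w i * f (y i)) \<le> (\<Sum>i<n. w i * (\<Sum>j<n. B i j * w j * f (x j)))"
  proof (intro sum_mono mult_left_mono)
    fix i assume "i \<in> {..<n}"
    then have i: "i < n" by simp
    \<comment> \<open>\<open>convex_on_sum\<close> asks for a nonempty index set; the row index
      itself is a member.\<close>
    then have "{..<n} \<noteq> {}" by auto
    then show "f (y i) \<le> (\<Sum>j<n. B i j * w j * f (x j))"
      using convex_on_sum [OF _ _ f stochastic [OF i], where y = x] i B w by (simp add: y)
    show "0 \<le> w i" using w i by simp
  qed
  also have "\<dots> = (\<Sum>i<n. \<Sum>j<n. w i * B i j * (w j * f (x j)))"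
    by (simp add: sum_distrib_left mult_ac)
  also have "\<dots> = (\<Sum>j<n. (\<Sum>i<n. w i * B i j) * (w j * f (x j)))"
    by (subst sum.swap) (simp add: sum_distrib_right)
  also have "\<dots> = (\<Sum>j<n. w j * f (x j))"
    using invariant by simp
  finally show ?thesis .
qed

section \<open>Polynomials vanishing on tensor grids, and the local spaces Q^k\<close>

text \<open>Root counting: a nonzero value forces a nonzero coefficient, hence at most
  \<open>k\<close> roots, but \<open>X\<close> supplies \<open>k + 1\<close> distinct ones.\<close>

lemma polyfun_vanishes:
  fixes c :: "nat \<Rightarrow> real" and X :: "nat \<Rightarrow> real"
  assumes inj: "inj_on X {..k}" and zero: "\<And>p. p \<le> k \<Longrightarrow> (\<Sum>i\<le>k. c i * X p ^ i) = 0"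
  shows "(\<Sum>i\<le>k. c i * z ^ i) = 0"
proof (rule ccontr)
  assume "(\<Sum>i\<le>k. c i * z ^ i) \<noteq> 0"
  then obtain i where "i \<le> k" "c i \<noteq> 0"
    by (metis (no_types, lifting) atMost_iff mult_zero_left sum.neutral)
  then have fin: "finite {z. (\<Sum>i\<le>k. c i * z ^ i) = 0}"
    and card: "card {z. (\<Sum>i\<le>k. c i * z ^ i) = 0} \<le> k"
    using polyfun_rootbound [of k c] by auto
  have "card (X ` {..k}) \<le> card {z. (\<Sum>i\<le>k. c i * z ^ i) = 0}"
    using zero by (intro card_mono fin) auto
  with card inj show False by (simp add: card_image)
qed

text \<open>The univariate case is used twice: first in x with the second variable frozen at a node,
  then in y with x arbitrary.\<close>

lemma tensor_polyfun_vanishes: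
  fixes c :: "nat \<Rightarrow> nat \<Rightarrow> real" and X Y :: "nat \<Rightarrow> real"
  assumes X: "inj_on X {..k}" and Y: "inj_on Y {..k}"
    and zero: "\<And>p q. p \<le> k \<Longrightarrow> q \<le> k \<Longrightarrow> (\<Sum>i\<le>k. \<Sum>j\<le>k. c i j * X p ^ i * Y q ^ j) = 0"
  shows "(\<Sum>i\<le>k. \<Sum>j\<le>k. c i j * x ^ i * y ^ j) = 0"
proof -
  have in_x: "(\<Sum>i\<le>k. \<Sum>j\<le>k. c i j * s ^ i * t ^ j) = (\<Sum>i\<le>k. (\<Sum>j\<le>k. c i j * t ^ j) * s ^ i)" for s t
    by (simp add: sum_distrib_right sum_distrib_left mult_ac)
  have in_y: "(\<Sum>i\<le>k. \<Sum>j\<le>k. c i j * s ^ i * t ^ j) = (\<Sum>j\<le>k. (\<Sum>i\<le>k. c i j * s ^ i) * t ^ j)" for s t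
    by (subst sum.swap) (simp add: sum_distrib_right)
  have "(\<Sum>i\<le>k. \<Sum>j\<le>k. c i j * x ^ i * Y q ^ j) = 0" if "q \<le> k" for q
    unfolding in_x using zero [OF _ that, unfolded in_x] by (rule polyfun_vanishes [OF X])
  then show ?thesis
    unfolding in_y by (rule polyfun_vanishes [OF Y])
qed

lemma is_Qk_on_const: "is_Qk_on k E (\<lambda>_. a)"
  unfolding is_Qk_on_def
proof (intro exI allI impI)
  fix x y :: real
  have "(\<Sum>i\<le>k. \<Sum>j\<le>k. (if i = 0 \<and> j = 0 then a else 0) * x ^ i * y ^ j)
      = (\<Sum>i\<le>k. \<Sum>j\<le>k. if j = 0 then (if i = 0 then a else 0) else 0)"
    by (intro sum.cong refl) auto
  then show "a = (\<Sum>i\<le>k. \<Sum>j\<le>k. (if i = 0 \<and> j = 0 then a else 0) * x ^ i * y ^ j)"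
    by (simp only: sum.delta finite_atMost) simp
qed

lemma is_Qk_on_diff:
  assumes "is_Qk_on k E v" "is_Qk_on k E w"
  shows "is_Qk_on k E (\<lambda>x. v x - w x)"
proof -
  obtain c where "\<forall>x y. (x, y) \<in> E \<longrightarrow> v (x, y) = (\<Sum>i\<le>k. \<Sum>j\<le>k. c i j * x ^ i * y ^ j)"
    using assms(1) unfolding is_Qk_on_def by blast
  moreover obtain d where "\<forall>x y. (x, y) \<in> E \<longrightarrow> w (x, y) = (\<Sum>i\<le>k. \<Sum>j\<le>k. d i j * x ^ i * y ^ j)"
    using assms(2) unfolding is_Qk_on_def by blast
  ultimately show ?thesis unfolding is_Qk_on_def
    by (intro exI [of _ "\<lambda>i j. c i j - d i j"])
      (simp add: left_diff_distrib sum_subtractf)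
qed

lemma is_Qk_on_lincomb:
  fixes v :: "nat \<Rightarrow> real \<times> real \<Rightarrow> real"
  assumes "\<And>l. l < n \<Longrightarrow> is_Qk_on k E (v l)"
  shows "is_Qk_on k E (\<lambda>x. \<Sum>l<n. a l * v l x)"
proof -
  \<comment> \<open>The bound on \<open>l\<close> sits below the existential quantifier so that
    \<open>choice\<close> yields one coefficient family for all \<open>l\<close>.\<close>
  have "\<forall>l. \<exists>c. l < n \<longrightarrow>
      (\<forall>x y. (x, y) \<in> E \<longrightarrow> v l (x, y) = (\<Sum>i\<le>k. \<Sum>j\<le>k. c i j * x ^ i * y ^ j))"
    using assms unfolding is_Qk_on_def by blast
  from choice [OF this] obtain c where c: "\<forall>l. l < n \<longrightarrow>
      (\<forall>x y. (x, y) \<in> E \<longrightarrow> v l (x, y) = (\<Sum>i\<le>k. \<Sum>j\<le>k. c l i j * x ^ i * y ^ j))"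
    by blast
  have "(\<Sum>l<n. a l * v l (x, y)) = (\<Sum>i\<le>k. \<Sum>j\<le>k. (\<Sum>l<n. a l * c l i j) * x ^ i * y ^ j)"
    if "(x, y) \<in> E" for x y
  proof -
    have "(\<Sum>l<n. a l * v l (x, y)) = (\<Sum>l<n. \<Sum>i\<le>k. \<Sum>j\<le>k. a l * c l i j * x ^ i * y ^ j)"
      using c that by (simp add: sum_distrib_left mult.assoc)
    also have "\<dots> = (\<Sum>i\<le>k. \<Sum>l<n. \<Sum>j\<le>k. a l * c l i j * x ^ i * y ^ j)"
      by (rule sum.swap)
    also have "\<dots> = (\<Sum>i\<le>k. \<Sum>j\<le>k. \<Sum>l<n. a l * c l i j * x ^ i * y ^ j)"
      by (intro sum.cong refl sum.swap)
    finally show ?thesis by (simp add: sum_distrib_right)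
  qed
  then show ?thesis unfolding is_Qk_on_def
    by (intro exI [of _ "\<lambda>i j. \<Sum>l<n. a l * c l i j"]) simp
qed

text \<open>\<open>v\<close> agrees with a polynomial only on \<open>E\<close>, which is enough
  because the derivative is taken within \<open>E\<close>.\<close>

lemma is_Qk_on_differentiable:
  assumes "is_Qk_on k E v" "x \<in> E"
  shows "v differentiable (at x within E)"
proof -
  obtain c where c: "\<And>s t. (s, t) \<in> E \<Longrightarrow> v (s, t) = (\<Sum>i\<le>k. \<Sum>j\<le>k. c i j * s ^ i * t ^ j)"
    using assms(1) unfolding is_Qk_on_def by blast
  have lin: "fst differentiable F" "snd differentiable F" for F :: "(real \<times> real) filter"
    unfolding differentiable_def
    by (auto intro: bounded_linear_imp_has_derivative bounded_linear_fst bounded_linear_snd)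
  have "(\<lambda>z. \<Sum>i\<le>k. \<Sum>j\<le>k. c i j * fst z ^ i * snd z ^ j) differentiable (at x within E)"
    by (intro differentiable_sum differentiable_mult differentiable_power differentiable_const lin
        ballI finite_atMost)
  then obtain D where "((\<lambda>z. \<Sum>i\<le>k. \<Sum>j\<le>k. c i j * fst z ^ i * snd z ^ j) has_derivative D) (at x within E)"
    unfolding differentiable_def by blast
  then have "(v has_derivative D) (at x within E)"
    by (rule has_derivative_transform [OF assms(2), rotated]) (use c in auto)
  then show ?thesis unfolding differentiable_def by blast
qed

section \<open>Quadrature nodes as points of a uniform grid\<close>

text \<open>For these two degrees the Gauss-Lobatto nodes are equally spaced, so mapping [-1,1] to
  [0,1] sends them to the multiples of 1/k. This makes the quadrature points of all cells fit one
  uniform grid.\<close>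

lemma gl_node_affine:
  assumes "k \<in> {1, 2}" "p \<le> k"
  shows "(1 + gl_node k p) / 2 = real p / real k"
proof -
  have "p = 0 \<or> p = 1 \<or> p = 2" using assms by auto
  then show ?thesis using assms by (auto simp: gl_node_def)
qed

lemma gl_weight_nonneg:
  assumes "k \<in> {1, 2}" "p \<le> k"
  shows "0 \<le> gl_weight k p"
proof -
  have "p = 0 \<or> p = 1 \<or> p = 2" using assms by auto
  then show ?thesis using assms by (auto simp: gl_weight_def)
qed

lemma quad_point_eq:
  assumes "k \<in> {1, 2}" "p \<le> k" "q \<le> k"
  shows "quad_point k L m a b p q =
    (- L + mesh_size L m * (real a + real p / real k), - L + mesh_size L m * (real b + real q / real k))"
  using assms by (simp add: quad_point_def gl_node_affine Let_def)

lemma quad_point_in_cell: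
  assumes "k \<in> {1, 2}" "p \<le> k" "q \<le> k" "L > 0"
  shows "quad_point k L m a b p q \<in> cell L m a b"
proof -
  have h: "0 \<le> mesh_size L m" using assms by (simp add: mesh_size_def)
  have bounds: "real c * mesh_size L m \<le> mesh_size L m * (real c + real r / real k)"
      "mesh_size L m * (real c + real r / real k) \<le> real (c + 1) * mesh_size L m"
    if "r \<le> k" for c r
  proof -
    have "real r / real k \<le> 1" using that assms by (simp add: divide_le_eq)
    then have "mesh_size L m * (real r / real k) \<le> mesh_size L m * 1"
      using h by (intro mult_left_mono) auto
    then show "mesh_size L m * (real c + real r / real k) \<le> real (c + 1) * mesh_size L m"
      by (simp add: algebra_simps)
    show "real c * mesh_size L m \<le> mesh_size L m * (real c + real r / real k)"
      using h by (simp add: algebra_simps)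
  qed
  show ?thesis
    using bounds [OF assms(2)] bounds [OF assms(3)]
    by (simp add: quad_point_eq [OF assms(1-3)] cell_def Let_def cbox_Pair_eq)
qed

text \<open>Local node \<open>p\<close> of cell \<open>a\<close> has global position
  \<open>k * a + p\<close>, and likewise in the second direction; neighbouring cells share the nodes
  on their interface. Row-major numbering turns the two positions into one index.\<close>

lemma quad_point_is_grid_point:
  assumes "k \<in> {1, 2}" "a < m" "b < m" "p \<le> k" "q \<le> k"
  obtains i where "i < (grid_size k m)\<^sup>2" "quad_point k L m a b p q = grid_point k L m i"
proof -
  define N where "N = grid_size k m"
  have "k * (c + 1) \<le> k * m" if "c < m" for c
    using that by (intro mult_le_mono2) simp
  \<comment> \<open>The largest position is \<open>k * m\<close>, the right end of the last cell;
    the added 1 in \<open>grid_size\<close> makes room for it.\<close>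
  then have lt: "k * c + r < N" if "c < m" "r \<le> k" for c r
    using that by (fastforce simp: N_def grid_size_def)
  define i where "i = (k * b + q) * N + (k * a + p)"
  have 1: "i mod N = k * a + p" "i div N = k * b + q"
    using lt [OF assms(2,4)] by (simp_all add: i_def)
  have "i < (k * b + q) * N + N" using lt [OF assms(2,4)] by (simp add: i_def)
  also have "\<dots> = (k * b + q + 1) * N" by simp
  also have "\<dots> \<le> N * N" using lt [OF assms(3,5)] by (intro mult_right_mono) auto
  finally have "i < N\<^sup>2" by (simp add: power2_eq_square)
  moreover have "quad_point k L m a b p q = grid_point k L m i"
    using assms 1 by (auto simp: quad_point_eq grid_point_def N_def [symmetric] Let_def field_simps)
  ultimately show thesis using that by (simp add: N_def)
qed

text \<open>Needed to evaluate the positivity of \<M>, which is assumed on \<open>Omega L\<close>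
  only, at the grid points.\<close>

lemma grid_point_in_Omega:
  assumes "k \<in> {1, 2}" "L > 0" "m \<ge> 1" "i < (grid_size k m)\<^sup>2"
  shows "grid_point k L m i \<in> Omega L"
proof -
  have "i mod grid_size k m \<le> k * m" "i div grid_size k m \<le> k * m"
    using assms(4) less_mult_imp_div_less [of i "grid_size k m" "grid_size k m"]
      mod_less_divisor [of "grid_size k m" i]
    by (auto simp: grid_size_def power2_eq_square simp del: mod_less_divisor)
  moreover have "- L \<le> - L + real r * (mesh_size L m / real k)"
      "- L + real r * (mesh_size L m / real k) \<le> L" if "r \<le> k * m" for r
  proof -
    have h: "mesh_size L m / real k \<ge> 0" using assms by (simp add: mesh_size_def)
    then show "- L \<le> - L + real r * (mesh_size L m / real k)"
      using mult_nonneg_nonneg [OF of_nat_0_le_iff [of r] h] by linarith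
    have "real r * (mesh_size L m / real k) \<le> real (k * m) * (mesh_size L m / real k)"
      using that by (intro mult_right_mono h) (simp only: of_nat_le_iff)
    \<comment> \<open>The \<open>k * m\<close> steps of length h/k span the whole side of the
      square.\<close>
    also have "\<dots> = 2 * L" using assms by (auto simp: mesh_size_def)
    finally show "- L + real r * (mesh_size L m / real k) \<le> L" by simp
  qed
  ultimately show ?thesis
    by (simp add: grid_point_def Omega_def Let_def cbox_Pair_eq)
qed

section \<open>Nodal expansion in V^h\<close>

text \<open>Unisolvence of local interpolation: since the mesh size is positive, the quadrature
  points of a cell form a tensor grid with \<open>k + 1\<close> distinct coordinates in each
  direction.\<close>

lemma is_Qk_on_vanishes:
  assumes "k \<in> {1, 2}" "L > 0" "m \<ge> 1" "is_Qk_on k (cell L m a b) v"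
    and zero: "\<And>p q. p \<le> k \<Longrightarrow> q \<le> k \<Longrightarrow> v (quad_point k L m a b p q) = 0"
    and "x \<in> cell L m a b"
  shows "v x = 0"
proof -
  obtain c where c: "\<And>s t. (s, t) \<in> cell L m a b \<Longrightarrow> v (s, t) = (\<Sum>i\<le>k. \<Sum>j\<le>k. c i j * s ^ i * t ^ j)"
    using assms(4) unfolding is_Qk_on_def by blast
  define X where "X d p = - L + mesh_size L m * (real d + real p / real k)" for d p :: nat
  have X: "inj_on (X d) {..k}" for d
    using assms by (auto simp: inj_on_def X_def mesh_size_def)
  have node: "quad_point k L m a b p q = (X a p, X b q)" if "p \<le> k" "q \<le> k" for p q
    using that assms(1) by (simp add: quad_point_eq X_def)
  have "(\<Sum>i\<le>k. \<Sum>j\<le>k. c i j * X a p ^ i * X b q ^ j) = 0" if "p \<le> k" "q \<le> k" for p q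
    using c [of "X a p" "X b q"] zero [OF that] quad_point_in_cell [OF assms(1) that assms(2), of m a b]
    by (simp add: node [OF that])
  then have "(\<Sum>i\<le>k. \<Sum>j\<le>k. c i j * fst x ^ i * snd x ^ j) = 0"
    by (rule tensor_polyfun_vanishes [OF X X])
  then show ?thesis using c [of "fst x" "snd x"] assms(6) by simp
qed

lemma Vh_is_Qk_on: "v \<in> Vh k L m \<Longrightarrow> a < m \<Longrightarrow> b < m \<Longrightarrow> is_Qk_on k (cell L m a b) v"
  by (auto simp: Vh_def mesh_def)

lemma one_in_Vh: "(\<lambda>_. 1) \<in> Vh k L m"
  by (simp add: Vh_def is_Qk_on_const)

lemma lagrange_basis_in_Vh: "lagrange_basis k L m \<phi> \<Longrightarrow> i < (grid_size k m)\<^sup>2 \<Longrightarrow> \<phi> i \<in> Vh k L m"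
  by (simp add: lagrange_basis_def)

lemma lagrange_basis_grid_point:
  "lagrange_basis k L m \<phi> \<Longrightarrow> i < (grid_size k m)\<^sup>2 \<Longrightarrow> j < (grid_size k m)\<^sup>2 \<Longrightarrow>
    \<phi> i (grid_point k L m j) = (if i = j then 1 else 0)"
  by (simp add: lagrange_basis_def)

text \<open>\<open>v\<close> minus its nodal interpolant is again Q^k on the cell and vanishes at
  all quadrature points of the cell, these being grid points; unisolvence finishes the
  argument.\<close>

lemma Vh_expansion:
  assumes "k \<in> {1, 2}" "L > 0" "m \<ge> 1" "lagrange_basis k L m \<phi>" "v \<in> Vh k L m"
    and "a < m" "b < m" "x \<in> cell L m a b"
  shows "v x = (\<Sum>j<(grid_size k m)\<^sup>2. v (grid_point k L m j) * \<phi> j x)"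
proof -
  let ?w = "\<lambda>x. v x - (\<Sum>j<(grid_size k m)\<^sup>2. v (grid_point k L m j) * \<phi> j x)"
  have "is_Qk_on k (cell L m a b) ?w"
    by (intro is_Qk_on_diff is_Qk_on_lincomb)
      (use Vh_is_Qk_on lagrange_basis_in_Vh [OF assms(4)] assms(5-7) in auto)
  moreover have "?w (quad_point k L m a b p q) = 0" if pq: "p \<le> k" "q \<le> k" for p q
  proof -
    obtain i where i: "i < (grid_size k m)\<^sup>2" "quad_point k L m a b p q = grid_point k L m i"
      using quad_point_is_grid_point [OF assms(1,6,7) pq] .
    have "(\<Sum>j<(grid_size k m)\<^sup>2. v (grid_point k L m j) * \<phi> j (grid_point k L m i))
        = (\<Sum>j<(grid_size k m)\<^sup>2. if j = i then v (grid_point k L m i) else 0)"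
      using i(1) by (intro sum.cong) (auto simp: lagrange_basis_grid_point [OF assms(4)])
    then show ?thesis using i by simp
  qed
  ultimately have "?w x = 0"
    by (rule is_Qk_on_vanishes [OF assms(1-3) _ _ assms(8)])
  then show ?thesis by simp
qed

section \<open>Gradients taken from inside a cell\<close>

text \<open>\<open>frechet_derivative\<close> is a choice among derivatives, and on the boundary of
  a set uniqueness is not automatic. A cell is a box with sides of positive length, so its one-sided
  derivatives are unique even there.\<close>

lemma grad_eqI:
  assumes "L > 0" "m \<ge> 1" "x \<in> cell L m a b" "(v has_derivative v') (at x within cell L m a b)"
  shows "grad v (cell L m a b) x = (v' (1, 0), v' (0, 1))"
proof -
  let ?h = "mesh_size L m"
  define l where "l = (- L + real a * ?h, - L + real b * ?h)"
  define r where "r = (- L + real (a + 1) * ?h, - L + real (b + 1) * ?h)"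
  have cell: "cell L m a b = cbox l r" by (simp add: cell_def Let_def l_def r_def)
  have h: "0 < ?h" using assms by (simp add: mesh_size_def)
  have "inner l i < inner r i" if "i \<in> Basis" for i
    using that h by (auto simp: Basis_prod_def l_def r_def algebra_simps)
  then have "frechet_derivative v (at x within cell L m a b) = v'"
    using assms(3,4) unfolding cell by (intro frechet_derivative_within_cbox)
  then show ?thesis by (simp add: grad_def)
qed

lemma grad_const:
  assumes "L > 0" "m \<ge> 1" "x \<in> cell L m a b"
  shows "grad (\<lambda>_. c) (cell L m a b) x = 0"
  using grad_eqI [OF assms has_derivative_const] by (simp add: zero_prod_def)

text \<open>The nodal expansion is differentiated term by term. It is an identity on the closed
  cell, which determines the derivative within that cell, including at interface points.\<close>

lemma grad_expansion:
  assumes "k \<in> {1, 2}" "L > 0" "m \<ge> 1" "lagrange_basis k L m \<phi>" "v \<in> Vh k L m"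
    and "a < m" "b < m" "x \<in> cell L m a b"
  shows "grad v (cell L m a b) x =
    (\<Sum>j<(grid_size k m)\<^sup>2. v (grid_point k L m j) *\<^sub>R grad (\<phi> j) (cell L m a b) x)"
proof -
  let ?E = "cell L m a b" and ?n = "(grid_size k m)\<^sup>2"
  define d where "d j = frechet_derivative (\<phi> j) (at x within ?E)" for j
  have "(\<phi> j has_derivative d j) (at x within ?E)" if "j < ?n" for j
    unfolding d_def frechet_derivative_works [symmetric] using assms that
    by (intro is_Qk_on_differentiable Vh_is_Qk_on lagrange_basis_in_Vh)
  then have "((\<lambda>y. \<Sum>j<?n. v (grid_point k L m j) * \<phi> j y) has_derivative
      (\<lambda>y. \<Sum>j<?n. v (grid_point k L m j) * d j y)) (at x within ?E)"
    by (intro has_derivative_sum has_derivative_mult_right) auto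
  then have "(v has_derivative (\<lambda>y. \<Sum>j<?n. v (grid_point k L m j) * d j y)) (at x within ?E)"
    by (rule has_derivative_transform [rotated 2])
      (use Vh_expansion [OF assms(1-7)] assms(8) in auto)
  then have "grad v ?E x =
      (\<Sum>j<?n. v (grid_point k L m j) * d j (1, 0), \<Sum>j<?n. v (grid_point k L m j) * d j (0, 1))"
    by (rule grad_eqI [OF assms(2,3,8)])
  then show ?thesis
    by (simp add: grad_def d_def scaleR_prod_def sum_prod)
qed

section \<open>Linearity of the quadrature inner product, and mass lumping\<close>

text \<open>The quadrature sees only values at the nodes, so a pointwise identity there suffices.
  Letting both \<open>F'\<close> and \<open>G'\<close> depend on \<open>j\<close> covers linearity
  in either argument as well as mass lumping.\<close>

lemma dip_sum:
  assumes "\<And>a b p q. a < m \<Longrightarrow> b < m \<Longrightarrow> p \<le> k \<Longrightarrow> q \<le> k \<Longrightarrow>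
      inner (F (cell L m a b) (quad_point k L m a b p q)) (G (cell L m a b) (quad_point k L m a b p q))
      = (\<Sum>j<n. c j * inner (F' j (cell L m a b) (quad_point k L m a b p q))
                           (G' j (cell L m a b) (quad_point k L m a b p q)))"
  shows "dip k L m F G = (\<Sum>j<n. c j * dip k L m (F' j) (G' j))"
proof -
  let ?W = "\<lambda>p q. (mesh_size L m / 2)\<^sup>2 * gl_weight k p * gl_weight k q"
  let ?I = "\<lambda>j a b p q. ?W p q * inner (F' j (cell L m a b) (quad_point k L m a b p q))
      (G' j (cell L m a b) (quad_point k L m a b p q))"
  have "dip k L m F G = (\<Sum>a<m. \<Sum>b<m. \<Sum>p<k+1. \<Sum>q<k+1. \<Sum>j<n. c j * ?I j a b p q)"
    unfolding dip_def Let_def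
    by (intro sum.cong refl) (simp add: assms sum_distrib_left mult_ac)
  \<comment> \<open>The sum over \<open>j\<close> moves outward past one quadrature index at a
    time.\<close>
  also have "\<dots> = (\<Sum>a<m. \<Sum>b<m. \<Sum>p<k+1. \<Sum>j<n. \<Sum>q<k+1. c j * ?I j a b p q)"
    by (intro sum.cong refl sum.swap)
  also have "\<dots> = (\<Sum>a<m. \<Sum>b<m. \<Sum>j<n. \<Sum>p<k+1. \<Sum>q<k+1. c j * ?I j a b p q)"
    by (intro sum.cong refl sum.swap)
  also have "\<dots> = (\<Sum>a<m. \<Sum>j<n. \<Sum>b<m. \<Sum>p<k+1. \<Sum>q<k+1. c j * ?I j a b p q)"
    by (intro sum.cong refl sum.swap)
  also have "\<dots> = (\<Sum>j<n. \<Sum>a<m. \<Sum>b<m. \<Sum>p<k+1. \<Sum>q<k+1. c j * ?I j a b p q)"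
    by (rule sum.swap)
  finally show ?thesis
    by (simp add: dip_def Let_def sum_distrib_left del: sum.lessThan_Suc)
qed

lemma quad_weight_nonneg:
  assumes "k \<in> {1, 2}"
  shows "0 \<le> quad_weight k L m \<phi> i"
  unfolding quad_weight_def dip_def Let_def
  by (intro sum_nonneg mult_nonneg_nonneg gl_weight_nonneg assms) auto

text \<open>Mass lumping: every quadrature point is a grid point, where \<open>\<phi>\<^sub>i\<close> takes the values \<open>0\<close> and \<open>1\<close>.\<close>

lemma dip_lagrange_basis:
  assumes "k \<in> {1, 2}" "lagrange_basis k L m \<phi>" "i < (grid_size k m)\<^sup>2"
  shows "dip k L m (\<lambda>_. v) (\<lambda>_. \<phi> i) = quad_weight k L m \<phi> i * v (grid_point k L m i)"
proof -
  have "dip k L m (\<lambda>_. v) (\<lambda>_. \<phi> i)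
      = (\<Sum>j<Suc 0. v (grid_point k L m i) * dip k L m (\<lambda>_. \<phi> i) (\<lambda>_. \<phi> i))"
  proof (rule dip_sum)
    fix a b p q assume ab: "a < m" "b < m" and pq: "p \<le> k" "q \<le> k"
    obtain j where "j < (grid_size k m)\<^sup>2" "quad_point k L m a b p q = grid_point k L m j"
      using quad_point_is_grid_point [OF assms(1) ab pq] .
    \<comment> \<open>If the node is grid point \<open>i\<close>, then \<open>\<phi> i\<close> is 1
      and both sides equal the value of \<open>v\<close> there; at any other node
      \<open>\<phi> i\<close> is 0 and both sides vanish.\<close>
    then show "inner (v (quad_point k L m a b p q)) (\<phi> i (quad_point k L m a b p q))
        = (\<Sum>j<Suc 0. v (grid_point k L m i) *
            inner (\<phi> i (quad_point k L m a b p q)) (\<phi> i (quad_point k L m a b p q)))"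
      using lagrange_basis_grid_point [OF assms(2,3)] by auto
  qed
  then show ?thesis by (simp add: quad_weight_def)
qed

section \<open>The diffusion and convection form\<close>

text \<open>This is the scheme without its mass terms: trial function first, test function second,
  time step included. It is separated because a constant in either slot will make it vanish, which
  yields the row and column sums of the matrix.\<close>

definition transport_form :: "nat \<Rightarrow> real \<Rightarrow> nat \<Rightarrow> real \<Rightarrow> real \<Rightarrow> (real \<times> real \<Rightarrow> real)
    \<Rightarrow> (real \<times> real \<Rightarrow> real \<times> real) \<Rightarrow> (real \<times> real \<Rightarrow> real) \<Rightarrow> (real \<times> real \<Rightarrow> real) \<Rightarrow> real" where
  "transport_form k L m D dt \<M> u v \<psi> =
     dt * dip k L m (\<lambda>E x. (D * \<M> x) *\<^sub>R grad v E x) (grad \<psi>)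
     + dt * dip k L m (\<lambda>_ x. v x *\<^sub>R u x) (grad \<psi>)"

text \<open>The diffusion term uses the expansion of the gradient, the convection term that of the
  values. This identifies the matrix acting on nodal values with the form acting on
  functions.\<close>

lemma transport_form_expansion_left:
  assumes "k \<in> {1, 2}" "L > 0" "m \<ge> 1" "lagrange_basis k L m \<phi>" "v \<in> Vh k L m"
  shows "transport_form k L m D dt \<M> u v \<psi> =
    (\<Sum>j<(grid_size k m)\<^sup>2. v (grid_point k L m j) * transport_form k L m D dt \<M> u (\<phi> j) \<psi>)"
proof -
  let ?n = "(grid_size k m)\<^sup>2"
  have 1: "dip k L m (\<lambda>E x. (D * \<M> x) *\<^sub>R grad v E x) (grad \<psi>) =
      (\<Sum>j<?n. v (grid_point k L m j) * dip k L m (\<lambda>E x. (D * \<M> x) *\<^sub>R grad (\<phi> j) E x) (grad \<psi>))"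
    by (rule dip_sum)
      (simp add: grad_expansion [OF assms] quad_point_in_cell [OF assms(1) _ _ assms(2)]
        inner_sum_left sum_distrib_left mult_ac)
  have 2: "dip k L m (\<lambda>_ x. v x *\<^sub>R u x) (grad \<psi>) =
      (\<Sum>j<?n. v (grid_point k L m j) * dip k L m (\<lambda>_ x. \<phi> j x *\<^sub>R u x) (grad \<psi>))"
  proof (rule dip_sum)
    fix a b p q assume ab: "a < m" "b < m" and pq: "p \<le> k" "q \<le> k"
    let ?x = "quad_point k L m a b p q"
    have "v ?x = (\<Sum>j<?n. v (grid_point k L m j) * \<phi> j ?x)"
      using Vh_expansion [OF assms ab quad_point_in_cell [OF assms(1) pq assms(2)]] .
    then show "inner (v ?x *\<^sub>R u ?x) (grad \<psi> (cell L m a b) ?x) =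
        (\<Sum>j<?n. v (grid_point k L m j) * inner (\<phi> j ?x *\<^sub>R u ?x) (grad \<psi> (cell L m a b) ?x))"
      by (simp add: sum_distrib_right mult.assoc)
  qed
  show ?thesis
    unfolding transport_form_def 1 2 by (simp add: sum_distrib_left sum.distrib algebra_simps)
qed

lemma transport_form_expansion_right:
  assumes "k \<in> {1, 2}" "L > 0" "m \<ge> 1" "lagrange_basis k L m \<phi>" "\<psi> \<in> Vh k L m"
  shows "transport_form k L m D dt \<M> u v \<psi> =
    (\<Sum>j<(grid_size k m)\<^sup>2. \<psi> (grid_point k L m j) * transport_form k L m D dt \<M> u v (\<phi> j))"
proof -
  \<comment> \<open>Both terms see the test function only through its gradient, so one identity for
    arbitrary \<open>F\<close> serves for both.\<close>
  have 1: "dip k L m F (grad \<psi>) =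
      (\<Sum>j<(grid_size k m)\<^sup>2. \<psi> (grid_point k L m j) * dip k L m F (grad (\<phi> j)))" for F
    by (rule dip_sum)
      (simp add: grad_expansion [OF assms] quad_point_in_cell [OF assms(1) _ _ assms(2)] inner_sum_right)
  show ?thesis
    unfolding transport_form_def 1 by (simp add: sum_distrib_left sum.distrib algebra_simps)
qed

text \<open>Conservation of mass: testing with 1 leaves no gradient.\<close>

lemma transport_form_one_right:
  assumes "k \<in> {1, 2}" "L > 0" "m \<ge> 1"
  shows "transport_form k L m D dt \<M> u v (\<lambda>_. 1) = 0"
proof -
  have "dip k L m F (grad (\<lambda>_. 1)) = 0" for F
    unfolding dip_def Let_def
    by (intro sum.neutral ballI) (simp add: grad_const [OF assms(2,3)]
        quad_point_in_cell [OF assms(1) _ _ assms(2)] less_Suc_eq_le)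
  then show ?thesis by (simp add: transport_form_def)
qed

text \<open>The equilibrium g = 1, that is \<rho> = \<M>, is stationary: diffusion sees a zero
  gradient, and convection reduces to the discrete divergence constraint.\<close>

lemma transport_form_one_left:
  assumes "k \<in> {1, 2}" "L > 0" "m \<ge> 1" "discrete_div_free k L m u" "\<psi> \<in> Vh k L m"
  shows "transport_form k L m D dt \<M> u (\<lambda>_. 1) \<psi> = 0"
proof -
  have "dip k L m (\<lambda>E x. (D * \<M> x) *\<^sub>R grad (\<lambda>_. 1) E x) (grad \<psi>) = 0"
    unfolding dip_def Let_def
    by (intro sum.neutral ballI) (simp add: grad_const [OF assms(2,3)]
        quad_point_in_cell [OF assms(1) _ _ assms(2)] less_Suc_eq_le)
  then show ?thesis using assms(4,5) by (simp add: transport_form_def discrete_div_free_def)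
qed

section \<open>The scheme matrix and its inverse\<close>

lemma scheme_matrix_entry:
  assumes "i < (grid_size k m)\<^sup>2" "j < (grid_size k m)\<^sup>2"
  shows "scheme_matrix k L m D dt \<M> u \<phi> $$ (i, j) =
    (if i = j then quad_weight k L m \<phi> i * \<M> (grid_point k L m i) else 0)
    + transport_form k L m D dt \<M> u (\<phi> j) (\<phi> i)"
  using assms by (simp add: scheme_matrix_def transport_form_def Let_def mat_diag_mult_left)
   (simp add: mat_diag_def)

lemma monotone_matrixE:
  assumes "monotone_matrix A" "dim_row A = n"
  obtains B where "\<And>i j. i < n \<Longrightarrow> j < n \<Longrightarrow> 0 \<le> B i j"
    "\<And>i j. i < n \<Longrightarrow> j < n \<Longrightarrow> (\<Sum>l<n. A $$ (i, l) * B l j) = (if i = j then 1 else 0)"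
    "\<And>i j. i < n \<Longrightarrow> j < n \<Longrightarrow> (\<Sum>l<n. B i l * A $$ (l, j)) = (if i = j then 1 else 0)"
proof -
  obtain B where B: "A * B = 1\<^sub>m n" "B * A = 1\<^sub>m (dim_row B)"
    and nonneg: "\<forall>i<dim_row B. \<forall>j<dim_col B. 0 \<le> B $$ (i, j)"
    using assms by (auto simp: monotone_matrix_def inverts_mat_def)
  have A: "dim_col A = n" using assms by (simp add: monotone_matrix_def square_mat.simps)
  \<comment> \<open>The shape of \<open>B\<close> is read off the two product equations: the column
    counts of \<open>A * B\<close> and \<open>B * A\<close> are those of \<open>B\<close> and
    \<open>A\<close>.\<close>
  have cols: "dim_col B = n" using arg_cong [OF B(1), of dim_col] by simp
  have rows: "dim_row B = n" using arg_cong [OF B(2), of dim_col] A by simp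
  show thesis
  proof (rule that [of "\<lambda>i j. B $$ (i, j)"])
    fix i j assume ij: "i < n" "j < n"
    show "0 \<le> B $$ (i, j)" using nonneg ij rows cols by simp
    have "(A * B) $$ (i, j) = 1\<^sub>m n $$ (i, j)" using B by simp
    then show "(\<Sum>l<n. A $$ (i, l) * B $$ (l, j)) = (if i = j then 1 else 0)"
      using ij assms(2) A rows cols by (simp add: scalar_prod_def atLeast0LessThan)
    have "(B * A) $$ (i, j) = 1\<^sub>m n $$ (i, j)" using B rows by simp
    then show "(\<Sum>l<n. B $$ (i, l) * A $$ (l, j)) = (if i = j then 1 else 0)"
      using ij assms(2) A rows cols by (simp add: scalar_prod_def atLeast0LessThan)
  qed
qed

section \<open>Row sums, column sums and the energy inequality\<close>

theorem theorem4p1: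
  fixes k m :: nat and L D dt :: real
    and \<M> :: "real \<times> real \<Rightarrow> real" and u :: "real \<times> real \<Rightarrow> real \<times> real"
    and \<phi> :: "nat \<Rightarrow> real \<times> real \<Rightarrow> real" and g :: "nat \<Rightarrow> real \<times> real \<Rightarrow> real"
    and \<rho> :: "nat \<Rightarrow> nat \<Rightarrow> real" and n :: nat and f :: "real \<Rightarrow> real"
  assumes "k \<in> {1, 2}" and "L > 0" and "m \<ge> 1" and "D > 0" and "dt > 0"
    and "continuous_on (Omega L) \<M>" and "\<forall>x\<in>Omega L. \<M> x > 0"
    and "lagrange_basis k L m \<phi>"
    and "is_scheme_step k L m D dt \<M> u (g n) (g (Suc n))"
    and "discrete_div_free k L m u"
    and "monotone_scheme k L m D dt \<M> u \<phi>"
    and "convex_on UNIV f"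
    and "\<forall>l. \<forall>i<(grid_size k m)\<^sup>2. \<rho> l i = \<M> (grid_point k L m i) * g l (grid_point k L m i)"
  shows "(\<Sum>i<(grid_size k m)\<^sup>2. quad_weight k L m \<phi> i * \<M> (grid_point k L m i)
              * f (\<rho> (Suc n) i / \<M> (grid_point k L m i)))
       \<le> (\<Sum>i<(grid_size k m)\<^sup>2. quad_weight k L m \<phi> i * \<M> (grid_point k L m i)
              * f (\<rho> n i / \<M> (grid_point k L m i)))"
proof -
  note mesh = assms(1-3) and basis = assms(8)
  define N2 where "N2 = (grid_size k m)\<^sup>2"
  define x where "x = grid_point k L m"
  define w where "w i = quad_weight k L m \<phi> i * \<M> (x i)" for i
  define T where "T = transport_form k L m D dt \<M> u"
  define A where "A = scheme_matrix k L m D dt \<M> u \<phi>"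
  have A: "A $$ (i, j) = (if i = j then w i else 0) + T (\<phi> j) (\<phi> i)" if "i < N2" "j < N2" for i j
    using that by (simp add: A_def N2_def scheme_matrix_entry w_def x_def T_def)
  have \<phi>: "\<phi> i \<in> Vh k L m" if "i < N2" for i
    using lagrange_basis_in_Vh [OF basis] that by (simp add: N2_def)
  \<comment> \<open>Used twice: for the sign of the weights \<open>w i\<close>, and to cancel \<M>
    in the quotient of \<rho> by \<M>.\<close>
  have positive: "0 < \<M> (x i)" if "i < N2" for i
    using grid_point_in_Omega [OF mesh] that assms(7) by (simp add: N2_def x_def)
  have w: "0 \<le> w i" if "i < N2" for i
    using quad_weight_nonneg [OF mesh(1)] positive [OF that] by (simp add: w_def)
  \<comment> \<open>Row \<open>i\<close> of the matrix applied to the nodal values of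
    \<open>v\<close> is the left side of the scheme for \<open>v\<close>, tested with
    \<open>\<phi> i\<close>.\<close>
  have apply_A: "(\<Sum>j<N2. A $$ (i, j) * v (x j)) = w i * v (x i) + T v (\<phi> i)"
    if i: "i < N2" and v: "v \<in> Vh k L m" for i v
  proof -
    have "(\<Sum>j<N2. A $$ (i, j) * v (x j))
        = (\<Sum>j<N2. (if i = j then w i * v (x i) else 0) + v (x j) * T (\<phi> j) (\<phi> i))"
      using i by (intro sum.cong) (auto simp: A algebra_simps)
    also have "\<dots> = w i * v (x i) + T v (\<phi> i)"
      using i transport_form_expansion_left [OF mesh basis v]
      by (simp add: sum.distrib T_def N2_def x_def)
    finally show ?thesis .
  qed
  \<comment> \<open>The constant 1 has all nodal values 1, so a row sum is \<open>apply_A\<close> at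
    1.\<close>
  have rows: "(\<Sum>j<N2. A $$ (i, j)) = w i" if "i < N2" for i
    using apply_A [OF that one_in_Vh] transport_form_one_left [OF mesh assms(10) \<phi> [OF that]]
    by (simp add: T_def)
  have cols: "(\<Sum>i<N2. A $$ (i, j)) = w j" if "j < N2" for j
  proof -
    have "(\<Sum>i<N2. A $$ (i, j)) = (\<Sum>i<N2. (if i = j then w j else 0) + T (\<phi> j) (\<phi> i))"
      using that by (intro sum.cong) (auto simp: A)
    \<comment> \<open>Expanding the constant test function 1 in the basis gives every coefficient 1,
      so summing over the rows amounts to testing with 1.\<close>
    also have "\<dots> = w j + T (\<phi> j) (\<lambda>_. 1)"
      using that transport_form_expansion_right [OF mesh basis one_in_Vh]
      by (simp add: sum.distrib T_def N2_def)
    finally show ?thesis using transport_form_one_right [OF mesh] by (simp add: T_def)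
  qed
  have step: "(\<Sum>j<N2. A $$ (i, j) * g (Suc n) (x j)) = w i * g n (x i)" if "i < N2" for i
  proof -
    \<comment> \<open>Mass lumping makes the mass terms of both time levels diagonal with the same
      weights \<open>w i\<close>.\<close>
    have lump: "dip k L m (\<lambda>_ x. \<M> x * v x) (\<lambda>_. \<phi> i) = w i * v (x i)" for v
      using dip_lagrange_basis [OF mesh(1) basis] that by (simp add: w_def x_def N2_def)
    have g: "g (Suc n) \<in> Vh k L m" using assms(9) by (simp add: is_scheme_step_def)
    have "w i * g (Suc n) (x i) + T (g (Suc n)) (\<phi> i) = w i * g n (x i)"
      using assms(9) \<phi> [OF that]
      unfolding is_scheme_step_def lump [symmetric] T_def transport_form_def by (simp add: add.assoc)
    then show ?thesis using apply_A [OF that g] by simp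
  qed
  have "monotone_matrix A" "dim_row A = N2"
    using assms(11) by (simp_all add: monotone_scheme_def A_def N2_def scheme_matrix_def Let_def)
  then obtain B where "\<And>i j. i < N2 \<Longrightarrow> j < N2 \<Longrightarrow> 0 \<le> B i j"
    "\<And>i j. i < N2 \<Longrightarrow> j < N2 \<Longrightarrow> (\<Sum>l<N2. A $$ (i, l) * B l j) = (if i = j then 1 else 0)"
    "\<And>i j. i < N2 \<Longrightarrow> j < N2 \<Longrightarrow> (\<Sum>l<N2. B i l * A $$ (l, j)) = (if i = j then 1 else 0)"
    by (rule monotone_matrixE) blast
  then have "(\<Sum>i<N2. w i * f (g (Suc n) (x i))) \<le> (\<Sum>i<N2. w i * f (g n (x i)))"
    by (intro Jensen_invariant_weights [OF assms(12) w, where A = "\<lambda>i j. A $$ (i, j)" and B = B])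
      (use rows cols step in auto)
  moreover have "\<rho> l i / \<M> (x i) = g l (x i)" if "i < N2" for l i
    using assms(13) positive [OF that] that by (simp add: N2_def x_def)
  ultimately show ?thesis
    by (simp add: w_def N2_def x_def)
qed

end
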